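(* A polynomial $u\in\mathbb{Z}[x]$ is nilpotent at $2$ (that is, $u\in N_2$) if and only if it has one of the following forms for some $p(x)\in\mathbb{Z}[x]$, and in each case the index of nilpotency at $2$ and the associated finite sequence at $2$ are as stated: (1) $(x-2)p(x)$ (index $1$, associated finite sequence $2,0$); (2) $x-1+p(x)(x-1)(x-2)$ (index $2$, associated finite sequence $2,1,0$); (3) $-2(x-4)+p(x)(x-2)(x-4)$ (index $2$, associated finite sequence $2,4,0$); (4) $-3(x-3)+p(x)(x-2)(x-3)$ (index $2$, associated finite sequence $2,3,0$); (5) $-(x-1)(x-6)+p(x)(x-2)(x-4)(x-6)$ (index $3$, associated finite sequence $2,4,6,0$); (6) $-(x-5)(x^2-4x+5)+p(x)(x-2)(x-3)(x-4)(x-5)$ (index $4$, associated finite sequence $2,3,4,5,0$).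
   Context: $\mathbb{N}$ is the set of positive integers. For $u\in\mathbb{Z}[x]$ and $n\in\mathbb{N}$, $u^{(n)}$ denotes the $n$-fold composition $u\circ\cdots\circ u$. For $r\in\mathbb{Z}$, $u$ is called nilpotent at $r$ if there is $n\in\mathbb{N}$ with $u^{(n)}(r)=0$; the smallest such $n$ is called the index (of nilpotency) of $u$ at $r$. The zero polynomial is nilpotent at every $r$ with index $1$. $N_r$ denotes the set of all $u\in\mathbb{Z}[x]$ nilpotent at $r$. If $u$ is nilpotent at $r$ of index $m$, the finite sequence associated to $u$ at $r$ is $r,u(r),\ldots,u^{(m-1)}(r),0$. *)

theory Defs
  imports "HOL-Computational_Algebra.Polynomial"
begin

text \<open>For \<open>n \<ge> 1\<close> this is the \<open>n\<close>-fold composition \<open>u \<circ> \<dots> \<circ> u\<close>;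
  for \<open>n = 0\<close> it is the polynomial \<open>x\<close>.\<close>

definition poly_iterate :: "int poly \<Rightarrow> nat \<Rightarrow> int poly" where
  "poly_iterate u n = (pcompose u ^^ n) [:0, 1:]"

definition nilpotent_at :: "int poly \<Rightarrow> int \<Rightarrow> bool" where
  "nilpotent_at u r \<longleftrightarrow> (\<exists>n\<ge>1. poly (poly_iterate u n) r = 0)"

definition nilpotent_polys :: "int \<Rightarrow> int poly set" where
  "nilpotent_polys r = {u. nilpotent_at u r}"

text \<open>Meaningful only if \<open>u\<close> is nilpotent at \<open>r\<close>; the same applies to \<open>associated_seq\<close>.
  The bound \<open>n \<ge> 1\<close> matters for \<open>r = 0\<close>.\<close>

definition nilpotency_index :: "int poly \<Rightarrow> int \<Rightarrow> nat" where
  "nilpotency_index u r = (LEAST n. n \<ge> 1 \<and> poly (poly_iterate u n) r = 0)"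

definition associated_seq :: "int poly \<Rightarrow> int \<Rightarrow> int list" where
  "associated_seq u r =
     map (\<lambda>i. poly (poly_iterate u i) r) [0..<nilpotency_index u r] @ [0]"

end

theory Submission
  imports Defs
begin

text \<open>The orbit \<open>2 = a\<^sub>0, a\<^sub>1, \<dots>, a\<^sub>m = 0\<close> of a nilpotent integer polynomial has distinct entries,
  and its increments form a divisibility chain, because \<open>x - y\<close> divides \<open>u(x) - u(y)\<close>.
  Hence \<open>a\<^sub>1 - 2\<close> divides \<open>2\<close>, every increment divides the last one, which is \<open>- a\<^sub>m\<^sub>-\<^sub>1\<close>, and
  \<open>a\<^sub>m\<^sub>-\<^sub>1 - 2\<close> divides \<open>a\<^sub>1\<close>. This leaves finitely many pairs \<open>(a\<^sub>1, a\<^sub>m\<^sub>-\<^sub>1)\<close>, each of which either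
  determines the whole orbit or is contradictory. The polynomials with a given
  orbit are then one interpolating polynomial plus the multiples of the product of the linear
  factors at the nodes.\<close>

section \<open>Evaluation, divisibility and interpolation\<close>

lemma poly_iterate_eval: "poly (poly_iterate u n) r = (poly u ^^ n) r"
  by (induction n) (simp_all add: poly_iterate_def poly_pcompose)

lemma diff_dvd_poly_diff:
  fixes p :: "'a::comm_ring_1 poly"
  shows "x - y dvd poly p x - poly p y"
proof -
  have "poly (p - [:poly p y:]) y = 0" by simp
  then obtain q where "p - [:poly p y:] = [:-y, 1:] * q"
    unfolding poly_eq_0_iff_dvd by (rule dvdE)
  then have "poly (p - [:poly p y:]) x = poly ([:-y, 1:] * q) x" by simp
  then have "poly p x - poly p y = (x - y) * poly q x" by (simp add: algebra_simps)
  then show ?thesis by (rule dvdI)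
qed

lemma prod_linear_factors_dvd:
  fixes p :: "'a::idom poly"
  assumes "finite A" "\<And>a. a \<in> A \<Longrightarrow> poly p a = 0"
  shows "(\<Prod>a\<in>A. [:-a, 1:]) dvd p"
  using assms
proof (induction A arbitrary: p rule: finite_induct)
  case empty
  then show ?case by simp
next
  case (insert a A)
  then have "poly p a = 0" by simp
  then obtain q where q: "p = [:-a, 1:] * q"
    unfolding poly_eq_0_iff_dvd by (rule dvdE)
  have "poly q b = 0" if "b \<in> A" for b
  proof -
    have "poly p b = 0" "b \<noteq> a" using insert that by auto
    then show ?thesis by (simp add: q)
  qed
  then have "(\<Prod>a\<in>A. [:-a, 1:]) dvd q" by (rule insert.IH)
  then show ?case
    unfolding prod.insert[OF insert.hyps] q by (intro mult_dvd_mono dvd_refl)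
qed

text \<open>Apply the previous lemma to \<open>u - v\<close>. The nodes form a list so that the
  product later unfolds to the explicit factors in the desired order; distinctness lets the list
  product replace the set product.\<close>

lemma eq_add_linear_factors_if_eq_at_nodes:
  fixes u v :: "'a::idom poly"
  assumes "distinct as" "\<forall>a\<in>set as. poly u a = poly v a"
  shows "\<exists>p. u = v + p * (\<Prod>a\<leftarrow>as. [:-a, 1:])"
proof -
  have "(\<Prod>a\<in>set as. [:-a, 1:]) dvd u - v"
    using assms(2) by (intro prod_linear_factors_dvd) auto
  then have "(\<Prod>a\<leftarrow>as. [:-a, 1:]) dvd u - v"
    using assms(1) by (simp add: prod.distinct_set_conv_list)
  then show ?thesis by (metis add_diff_cancel_left' diff_eq_eq add.commute dvd_def mult.commute)
qed

section \<open>Index and associated sequence of an explicit orbit\<close>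

lemma nilpotency_index_eqI:
  assumes "n \<ge> 1" "(poly u ^^ n) r = 0" "\<And>i. 1 \<le> i \<Longrightarrow> i < n \<Longrightarrow> (poly u ^^ i) r \<noteq> 0"
  shows "nilpotency_index u r = n"
  unfolding nilpotency_index_def poly_iterate_eval
  using assms by (intro Least_equality) (auto simp: not_le[symmetric])

lemma associated_seq_eq:
  "associated_seq u r = map (\<lambda>i. (poly u ^^ i) r) [0..<nilpotency_index u r] @ [0]"
  by (simp add: associated_seq_def poly_iterate_eval)

lemma nilpotency_orbit_1:
  assumes "poly u r = 0"
  shows "nilpotency_index u r = 1 \<and> associated_seq u r = [r, 0]"
proof -
  have "nilpotency_index u r = 1"
    by (rule nilpotency_index_eqI) (use assms in auto)
  then show ?thesis by (simp add: associated_seq_eq)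
qed

lemma nilpotency_orbit_2:
  assumes "poly u r = a" "poly u a = 0" "a \<noteq> 0"
  shows "nilpotency_index u r = 2 \<and> associated_seq u r = [r, a, 0]"
proof -
  have "nilpotency_index u r = 2"
    by (rule nilpotency_index_eqI) (use assms in \<open>auto simp: numeral_eq_Suc less_Suc_eq\<close>)
  then show ?thesis by (simp add: associated_seq_eq numeral_eq_Suc assms)
qed

lemma nilpotency_orbit_3:
  assumes "poly u r = a" "poly u a = b" "poly u b = 0" "a \<noteq> 0" "b \<noteq> 0"
  shows "nilpotency_index u r = 3 \<and> associated_seq u r = [r, a, b, 0]"
proof -
  have "nilpotency_index u r = 3"
    by (rule nilpotency_index_eqI) (use assms in \<open>auto simp: numeral_eq_Suc less_Suc_eq\<close>)
  then show ?thesis by (simp add: associated_seq_eq numeral_eq_Suc assms)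
qed

lemma nilpotency_orbit_4:
  assumes "poly u r = a" "poly u a = b" "poly u b = c" "poly u c = 0" "a \<noteq> 0" "b \<noteq> 0" "c \<noteq> 0"
  shows "nilpotency_index u r = 4 \<and> associated_seq u r = [r, a, b, c, 0]"
proof -
  have "nilpotency_index u r = 4"
    by (rule nilpotency_index_eqI) (use assms in \<open>auto simp: numeral_eq_Suc less_Suc_eq\<close>)
  then show ?thesis by (simp add: associated_seq_eq numeral_eq_Suc assms)
qed

lemma nilpotent_atI: "n \<ge> 1 \<Longrightarrow> (poly u ^^ n) r = 0 \<Longrightarrow> nilpotent_at u r"
  by (auto simp: nilpotent_at_def poly_iterate_eval)

section \<open>Orbits up to the first hit of a value\<close>

lemma inj_on_orbit_before_hit:
  fixes f :: "'a \<Rightarrow> 'a"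
  assumes hit: "(f ^^ m) r = z" and before: "\<And>i. i < m \<Longrightarrow> (f ^^ i) r \<noteq> z"
  shows "inj_on (\<lambda>i. (f ^^ i) r) {..m}"
proof (rule linorder_inj_onI)
  fix i j assume ij: "i < j" "i \<in> {..m}" "j \<in> {..m}"
  show "(f ^^ i) r \<noteq> (f ^^ j) r"
  proof
    assume eq: "(f ^^ i) r = (f ^^ j) r"
    \<comment> \<open>A coincidence at \<open>i < j\<close> lets the orbit skip \<open>j - i\<close>
      steps, so \<open>z\<close> would be reached that much before time \<open>m\<close>.\<close>
    have "(f ^^ (m - j + i)) r = (f ^^ (m - j)) ((f ^^ i) r)" by (simp add: funpow_add)
    also have "\<dots> = (f ^^ (m - j + j)) r" by (simp add: eq funpow_add)
    also have "\<dots> = z" using ij hit by simp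
    finally have "(f ^^ (m - j + i)) r = z" .
    moreover have "m - j + i < m" using ij(1,3) unfolding atMost_iff by linarith
    ultimately show False using before by blast
  qed
qed auto

text \<open>If all increments have the same absolute value then, the entries being distinct, they
  cannot change sign.\<close>

lemma constant_step_progression:
  fixes a :: "nat \<Rightarrow> int"
  assumes inj: "inj_on a {..m}" and step: "\<And>i. i < m \<Longrightarrow> \<bar>a (Suc i) - a i\<bar> = \<bar>d\<bar>"
    and d: "a 1 = a 0 + d" and "i \<le> m"
  shows "a i = a 0 + int i * d"
  using \<open>i \<le> m\<close>
proof (induction i rule: induct_nat_012)
  case (ge2 k)
  have eqs: "a k = a 0 + int k * d" "a (Suc k) = a 0 + int (Suc k) * d"
    using ge2.IH ge2.prems by (meson Suc_leD)+
  have "a (Suc (Suc k)) \<noteq> a k"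
    using ge2.prems inj_onD[OF inj, of "Suc (Suc k)" k] by fastforce
  moreover have "\<bar>a (Suc (Suc k)) - a (Suc k)\<bar> = \<bar>d\<bar>"
    using step[of "Suc k"] ge2.prems by simp
  moreover have "a (Suc k) = a k + d" using eqs by (simp add: algebra_simps)
  ultimately have "a (Suc (Suc k)) = a (Suc k) + d" by linarith
  then show ?case using eqs by (simp add: algebra_simps)
qed (use d in auto)

section \<open>The possible orbits from 2\<close>

lemma dvd_small_int_cases:
  fixes x :: int
  shows "x dvd 1 \<Longrightarrow> x \<in> {1, -1}"
    and "x dvd 2 \<Longrightarrow> x \<in> {1, -1, 2, -2}"
    and "x dvd 3 \<Longrightarrow> x \<in> {1, -1, 3, -3}"
    and "x dvd 4 \<Longrightarrow> x \<in> {1, -1, 2, -2, 4, -4}"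
    and "x dvd 5 \<Longrightarrow> x \<in> {1, -1, 5, -5}"
    and "x dvd 6 \<Longrightarrow> x \<in> {1, -1, 2, -2, 3, -3, 6, -6}"
proof -
  have *: "x \<in> {-n..n}" if "x dvd n" "n > 0" for n :: int
    using dvd_imp_le_int[of n x] that by auto
  show "x dvd 1 \<Longrightarrow> x \<in> {1, -1}" using *[of 1] by (auto simp: upto.simps[of "-1"] upto.simps[of 0] upto.simps[of 1] simp flip: set_upto)
  show "x dvd 2 \<Longrightarrow> x \<in> {1, -1, 2, -2}" using *[of 2] by (auto simp: upto.simps[of "-1"] upto.simps[of 0] upto.simps[of 1] simp flip: set_upto)
  show "x dvd 3 \<Longrightarrow> x \<in> {1, -1, 3, -3}" using *[of 3] by (auto simp: upto.simps[of "-1"] upto.simps[of 0] upto.simps[of 1] simp flip: set_upto)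
  show "x dvd 4 \<Longrightarrow> x \<in> {1, -1, 2, -2, 4, -4}" using *[of 4] by (auto simp: upto.simps[of "-1"] upto.simps[of 0] upto.simps[of 1] simp flip: set_upto)
  show "x dvd 5 \<Longrightarrow> x \<in> {1, -1, 5, -5}" using *[of 5] by (auto simp: upto.simps[of "-1"] upto.simps[of 0] upto.simps[of 1] simp flip: set_upto)
  show "x dvd 6 \<Longrightarrow> x \<in> {1, -1, 2, -2, 3, -3, 6, -6}" using *[of 6] by (auto simp: upto.simps[of "-1"] upto.simps[of 0] upto.simps[of 1] simp flip: set_upto)
qed

text \<open>Polynomials enter only through \<open>diff_dvd\<close>; the rest is arithmetic of
  divisors along the orbit.\<close>

lemma orbit_from_2_cases:
  fixes f :: "int \<Rightarrow> int"
  assumes diff_dvd: "\<And>x y. x - y dvd f x - f y"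
    and hit: "(f ^^ m) 2 = 0" and before: "\<And>i. i < m \<Longrightarrow> (f ^^ i) 2 \<noteq> 0"
  shows "f 2 = 0 \<or> f 2 = 1 \<and> f 1 = 0 \<or> f 2 = 4 \<and> f 4 = 0 \<or> f 2 = 3 \<and> f 3 = 0 \<or>
    f 2 = 4 \<and> f 4 = 6 \<and> f 6 = 0 \<or> f 2 = 3 \<and> f 3 = 4 \<and> f 4 = 5 \<and> f 5 = 0"
proof -
  define a where "a i = (f ^^ i) 2" for i
  \<comment> \<open>The last entry before 0, so the last increment is \<open>- c\<close>.\<close>
  define c where "c = a (m - 1)"
  have a0: "a 0 = 2" and aSuc: "f (a i) = a (Suc i)" for i by (simp_all add: a_def)
  have a1: "a 1 = f 2" using aSuc[of 0] a0 by simp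
  have am: "a m = 0" using hit by (simp add: a_def)
  have inj: "inj_on a {..m}"
    unfolding a_def using hit before by (rule inj_on_orbit_before_hit)
  have neq: "a i \<noteq> a j" if "i \<noteq> j" "i \<le> m" "j \<le> m" for i j
    using inj that by (auto dest: inj_onD)
  have m: "m \<ge> 1" using am a0 by (cases m) auto
  have fc: "f c = 0" using am m aSuc[of "m - 1"] by (simp add: c_def)
  have step: "a (Suc i) - a i dvd a (Suc j) - a j" if "i \<le> j" for i j
    using that
  proof (induction j rule: dec_induct)
    case (step j)
    then show ?case using diff_dvd[of "a (Suc j)" "a j"] aSuc by (metis dvd_trans)
  qed simp
  \<comment> \<open>Telescoping: \<open>a k - a j\<close> is a sum of increments from
    \<open>j\<close> on, all multiples of the earlier one. Taking \<open>k = m\<close>, where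
    \<open>a m = 0\<close>, gives the claim.\<close>
  have tail: "a (Suc i) - a i dvd a j" if "i \<le> j" "j \<le> m" for i j
  proof -
    have "a (Suc i) - a i dvd a k - a j" if "j \<le> k" for k
      using that
    proof (induction k rule: dec_induct)
      case (step k)
      then have "a (Suc i) - a i dvd (a (Suc k) - a k) + (a k - a j)"
        using \<open>i \<le> j\<close> \<open>\<And>i j. i \<le> j \<Longrightarrow> a (Suc i) - a i dvd a (Suc j) - a j\<close>
        by (intro dvd_add) auto
      then show ?case by simp
    qed simp
    from this[of m] that am show ?thesis by simp
  qed
  have step_c: "a (Suc i) - a i dvd c" if "i < m" for i
    using tail[of i "m - 1"] that by (simp add: c_def)
  have d0: "f 2 - 2 dvd 2" using tail[of 0 0] a0 a1 by simp
  have c_dvd: "c - 2 dvd f 2" using diff_dvd[of c 2] fc by simp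
  show ?thesis
  proof (cases "f 2 = 0 \<or> f (f 2) = 0")
    case True
    \<comment> \<open>The first increment is 1, -1, 2 or -2, so \<open>f 2\<close> is 3, 1, 4 or 0:
      the orbits with at most two steps.\<close>
    then show ?thesis using dvd_small_int_cases(2)[OF d0] by auto
  next
    case False
    have a2: "a 2 = f (f 2)" using aSuc[of 1] a1 by (simp add: numeral_2_eq_2)
    have "m \<noteq> 1" "m \<noteq> 2" using False am a1 a2 by auto
    then have m3: "m \<ge> 3" using m by simp
    have c_neq: "c \<noteq> 0" "c \<noteq> 2" "c \<noteq> f 2"
      using neq[of "m - 1" m] neq[of "m - 1" 0] neq[of "m - 1" 1] am a0 a1 m3
      by (auto simp: c_def)
    have a2_neq: "a 2 \<noteq> 2" using neq[of 2 0] m3 a0 by auto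
    have d1: "a 2 - f 2 dvd c" "a 2 - f 2 dvd f 2"
      using step_c[of 1] tail[of 1 1] a1 m3 by (auto simp: numeral_2_eq_2)
    \<comment> \<open>Equal steps upward from 2 never come down to 0.\<close>
    have not_const: "\<exists>i<m. \<bar>a (Suc i) - a i\<bar> \<noteq> \<bar>d\<bar>" if "f 2 = 2 + d" "d > 0" for d
    proof (rule ccontr)
      assume "\<not> ?thesis"
      then have "a m = a 0 + int m * d"
        using that a0 a1 by (intro constant_step_progression[OF inj]) auto
      then show False using am a0 that by (smt (verit) mult_nonneg_nonneg of_nat_0_le_iff)
    qed
    consider "f 2 = 1" | "f 2 = 3" | "f 2 = 4"
      using False dvd_small_int_cases(2)[OF d0] by auto
    then show ?thesis
    proof cases
      case 1
      \<comment> \<open>\<open>a 2 - 1\<close> divides 1, so \<open>a 2\<close> is 2, a repetition,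
        or 0, excluded by \<open>False\<close>.\<close>
      then show ?thesis
        using dvd_small_int_cases(1)[of "a 2 - 1"] d1 False a2 a2_neq by auto
    next
      case 2
      \<comment> \<open>The divisors of 3 allow 3, 1, 5 and -1; the value 3 is \<open>f 2\<close>
        itself.\<close>
      have "c \<in> {1, -1, 5}" using dvd_small_int_cases(3)[of "c - 2"] c_dvd 2 c_neq by auto
      moreover have "\<bar>c\<bar> \<noteq> 1"
      proof
        assume "\<bar>c\<bar> = 1"
        then have "\<bar>a (Suc i) - a i\<bar> = \<bar>1\<bar>" if "i < m" for i
          using step_c[OF that] by (metis abs_one dvd_abs_iff zdvd1_eq)
        then show False using not_const[of 1] 2 by auto
      qed
      ultimately have c: "c = 5" by auto
      \<comment> \<open>\<open>a 2 - 3\<close> divides both 5 and 3, so \<open>a 2\<close> is 4 or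
        2, and 2 is the starting point.\<close>
      have "a 2 = 4"
        using dvd_small_int_cases(3)[of "a 2 - 3"] dvd_small_int_cases(5)[of "a 2 - 3"]
          d1 2 c a2_neq by auto
      moreover have "a 3 = 5"
      proof -
        \<comment> \<open>These leave 5 and 3 for \<open>a 3\<close>, and 3 is already
          \<open>a 1\<close>.\<close>
        have "a 3 - 4 dvd 5" "a 3 - 4 dvd 4"
          using step_c[of 2] tail[of 2 2] m3 c \<open>a 2 = 4\<close> by (auto simp: numeral_3_eq_3)
        moreover have "a 3 \<noteq> 3" using neq[of 3 1] a1 2 m3 by auto
        ultimately show ?thesis
          using dvd_small_int_cases(4)[of "a 3 - 4"] dvd_small_int_cases(5)[of "a 3 - 4"] by auto
      qed
      ultimately show ?thesis using 2 a2 aSuc[of 2] fc c by (simp add: numeral_3_eq_3)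
    next
      case 3
      \<comment> \<open>The first increment is 2, and it divides every entry.\<close>
      have even: "2 dvd a i" if "i \<le> m" for i
        using tail[of 0 i] that a0 a1 3 by simp
      have "2 dvd c" using even by (simp add: c_def)
      then have "c \<in> {6, -2}" using dvd_small_int_cases(4)[of "c - 2"] c_dvd 3 c_neq by auto
      moreover have "c \<noteq> -2"
      proof
        assume "c = -2"
        \<comment> \<open>Each increment divides 2 and is even, which forces a constant step
          size.\<close>
        have "\<bar>a (Suc i) - a i\<bar> = \<bar>2\<bar>" if "i < m" for i
        proof -
          have "a (Suc i) - a i dvd 2" using step_c[OF that] \<open>c = -2\<close> by simp
          moreover have "2 dvd a (Suc i) - a i"
            using even[of i] even[of "Suc i"] that by (intro dvd_diff) simp_all
          moreover have "\<bar>d\<bar> = \<bar>2\<bar>" if "d dvd 2" "2 dvd d" for d :: int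
            using that by (simp add: zdvd_antisym_abs)
          ultimately show ?thesis by blast
        qed
        then show False using not_const[of 2] 3 by auto
      qed
      ultimately have c: "c = 6" by auto
      have "2 dvd a 2" using even[of 2] m3 by simp
      \<comment> \<open>\<open>a 2 - 4\<close> divides both 6 and 4 and is even, so
        \<open>a 2\<close> is 6 or the starting point 2.\<close>
      then have "a 2 = 6"
        using dvd_small_int_cases(4)[of "a 2 - 4"] dvd_small_int_cases(6)[of "a 2 - 4"]
          d1 3 c a2_neq by auto
      then show ?thesis using 3 a2 fc c by simp
    qed
  qed
qed

section \<open>From orbits to polynomials and back\<close>

theorem theorem3p2:
  fixes u :: "int poly"
  shows "(u \<in> nilpotent_polys 2 \<longleftrightarrow>
       ((\<exists>p. u = [:-2, 1:] * p) \<or>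
        (\<exists>p. u = [:-1, 1:] + p * [:-1, 1:] * [:-2, 1:]) \<or>
        (\<exists>p. u = smult (-2) [:-4, 1:] + p * [:-2, 1:] * [:-4, 1:]) \<or>
        (\<exists>p. u = smult (-3) [:-3, 1:] + p * [:-2, 1:] * [:-3, 1:]) \<or>
        (\<exists>p. u = - ([:-1, 1:] * [:-6, 1:]) + p * [:-2, 1:] * [:-4, 1:] * [:-6, 1:]) \<or>
        (\<exists>p. u = - ([:-5, 1:] * [:5, -4, 1:]) + p * [:-2, 1:] * [:-3, 1:] * [:-4, 1:] * [:-5, 1:])))
    \<and> (\<forall>p. u = [:-2, 1:] * p \<longrightarrow>
         nilpotency_index u 2 = 1 \<and> associated_seq u 2 = [2, 0])
    \<and> (\<forall>p. u = [:-1, 1:] + p * [:-1, 1:] * [:-2, 1:] \<longrightarrow>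
         nilpotency_index u 2 = 2 \<and> associated_seq u 2 = [2, 1, 0])
    \<and> (\<forall>p. u = smult (-2) [:-4, 1:] + p * [:-2, 1:] * [:-4, 1:] \<longrightarrow>
         nilpotency_index u 2 = 2 \<and> associated_seq u 2 = [2, 4, 0])
    \<and> (\<forall>p. u = smult (-3) [:-3, 1:] + p * [:-2, 1:] * [:-3, 1:] \<longrightarrow>
         nilpotency_index u 2 = 2 \<and> associated_seq u 2 = [2, 3, 0])
    \<and> (\<forall>p. u = - ([:-1, 1:] * [:-6, 1:]) + p * [:-2, 1:] * [:-4, 1:] * [:-6, 1:] \<longrightarrow>
         nilpotency_index u 2 = 3 \<and> associated_seq u 2 = [2, 4, 6, 0])
    \<and> (\<forall>p. u = - ([:-5, 1:] * [:5, -4, 1:]) + p * [:-2, 1:] * [:-3, 1:] * [:-4, 1:] * [:-5, 1:] \<longrightarrow>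
         nilpotency_index u 2 = 4 \<and> associated_seq u 2 = [2, 3, 4, 5, 0])"
proof (intro conjI allI impI iffI)
  assume "u \<in> nilpotent_polys 2"
  then have ex: "\<exists>n. (poly u ^^ n) 2 = 0"
    by (auto simp: nilpotent_polys_def nilpotent_at_def poly_iterate_eval)
  \<comment> \<open>Allowing \<open>n = 0\<close> here is harmless because the orbit starts at 2,
    not 0.\<close>
  define m where "m = (LEAST n. (poly u ^^ n) 2 = 0)"
  have "(poly u ^^ m) 2 = 0"
    unfolding m_def using ex by (rule LeastI_ex)
  moreover have "(poly u ^^ i) 2 \<noteq> 0" if "i < m" for i
    using that not_less_Least unfolding m_def by blast
  ultimately consider
    "poly u 2 = 0"
    | "poly u 2 = 1" "poly u 1 = 0"
    | "poly u 2 = 4" "poly u 4 = 0"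
    | "poly u 2 = 3" "poly u 3 = 0"
    | "poly u 2 = 4" "poly u 4 = 6" "poly u 6 = 0"
    | "poly u 2 = 3" "poly u 3 = 4" "poly u 4 = 5" "poly u 5 = 0"
    using orbit_from_2_cases[OF diff_dvd_poly_diff] by metis
  then show "(\<exists>p. u = [:-2, 1:] * p) \<or>
      (\<exists>p. u = [:-1, 1:] + p * [:-1, 1:] * [:-2, 1:]) \<or>
      (\<exists>p. u = smult (-2) [:-4, 1:] + p * [:-2, 1:] * [:-4, 1:]) \<or>
      (\<exists>p. u = smult (-3) [:-3, 1:] + p * [:-2, 1:] * [:-3, 1:]) \<or>
      (\<exists>p. u = - ([:-1, 1:] * [:-6, 1:]) + p * [:-2, 1:] * [:-4, 1:] * [:-6, 1:]) \<or>
      (\<exists>p. u = - ([:-5, 1:] * [:5, -4, 1:]) + p * [:-2, 1:] * [:-3, 1:] * [:-4, 1:] * [:-5, 1:])"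
  proof cases
    case 1
    then have "\<exists>p. u = [:-2, 1:] * p" unfolding poly_eq_0_iff_dvd dvd_def .
    then show ?thesis by blast
  next
    case 2
    \<comment> \<open>Here and in the cases below, the explicit summand already takes the orbit
      values at the nodes, which are the entries before 0.\<close>
    then have "\<exists>p. u = [:-1, 1:] + p * (\<Prod>a\<leftarrow>[1, 2]. [:-a, 1:])"
      by (intro eq_add_linear_factors_if_eq_at_nodes) auto
    then show ?thesis by (simp only: list.map prod_list.Cons prod_list.Nil mult_1_right mult.assoc) blast
  next
    case 3
    then have "\<exists>p. u = smult (-2) [:-4, 1:] + p * (\<Prod>a\<leftarrow>[2, 4]. [:-a, 1:])"
      by (intro eq_add_linear_factors_if_eq_at_nodes) auto
    then show ?thesis by (simp only: list.map prod_list.Cons prod_list.Nil mult_1_right mult.assoc) blast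
  next
    case 4
    then have "\<exists>p. u = smult (-3) [:-3, 1:] + p * (\<Prod>a\<leftarrow>[2, 3]. [:-a, 1:])"
      by (intro eq_add_linear_factors_if_eq_at_nodes) auto
    then show ?thesis by (simp only: list.map prod_list.Cons prod_list.Nil mult_1_right mult.assoc) blast
  next
    case 5
    then have "\<exists>p. u = - ([:-1, 1:] * [:-6, 1:]) + p * (\<Prod>a\<leftarrow>[2, 4, 6]. [:-a, 1:])"
      by (intro eq_add_linear_factors_if_eq_at_nodes) auto
    then show ?thesis by (simp only: list.map prod_list.Cons prod_list.Nil mult_1_right mult.assoc) blast
  next
    case 6
    then have "\<exists>p. u = - ([:-5, 1:] * [:5, -4, 1:]) + p * (\<Prod>a\<leftarrow>[2, 3, 4, 5]. [:-a, 1:])"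
      by (intro eq_add_linear_factors_if_eq_at_nodes) auto
    then show ?thesis by (simp only: list.map prod_list.Cons prod_list.Nil mult_1_right mult.assoc) blast
  qed
next
  assume "(\<exists>p. u = [:-2, 1:] * p) \<or>
      (\<exists>p. u = [:-1, 1:] + p * [:-1, 1:] * [:-2, 1:]) \<or>
      (\<exists>p. u = smult (-2) [:-4, 1:] + p * [:-2, 1:] * [:-4, 1:]) \<or>
      (\<exists>p. u = smult (-3) [:-3, 1:] + p * [:-2, 1:] * [:-3, 1:]) \<or>
      (\<exists>p. u = - ([:-1, 1:] * [:-6, 1:]) + p * [:-2, 1:] * [:-4, 1:] * [:-6, 1:]) \<or>
      (\<exists>p. u = - ([:-5, 1:] * [:5, -4, 1:]) + p * [:-2, 1:] * [:-3, 1:] * [:-4, 1:] * [:-5, 1:])"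
  \<comment> \<open>The multiple of \<open>p\<close> vanishes at every entry before 0, so evaluation
    follows the stated orbit, which has at most four steps.\<close>
  then have "(poly u ^^ 1) 2 = 0 \<or> (poly u ^^ 2) 2 = 0 \<or> (poly u ^^ 3) 2 = 0 \<or> (poly u ^^ 4) 2 = 0"
    by (elim disjE exE) (simp_all add: eval_nat_numeral)
  then show "u \<in> nilpotent_polys 2"
    unfolding nilpotent_polys_def
    by (auto intro: nilpotent_atI[of 1] nilpotent_atI[of 2] nilpotent_atI[of 3] nilpotent_atI[of 4])
next
  fix p assume "u = [:-2, 1:] * p"
  then show "nilpotency_index u 2 = 1" "associated_seq u 2 = [2, 0]"
    using nilpotency_orbit_1[of u 2] by simp_all
next
  fix p assume "u = [:-1, 1:] + p * [:-1, 1:] * [:-2, 1:]"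
  then show "nilpotency_index u 2 = 2" "associated_seq u 2 = [2, 1, 0]"
    using nilpotency_orbit_2[of u 2 1] by simp_all
next
  fix p assume "u = smult (-2) [:-4, 1:] + p * [:-2, 1:] * [:-4, 1:]"
  then show "nilpotency_index u 2 = 2" "associated_seq u 2 = [2, 4, 0]"
    using nilpotency_orbit_2[of u 2 4] by simp_all
next
  fix p assume "u = smult (-3) [:-3, 1:] + p * [:-2, 1:] * [:-3, 1:]"
  then show "nilpotency_index u 2 = 2" "associated_seq u 2 = [2, 3, 0]"
    using nilpotency_orbit_2[of u 2 3] by simp_all
next
  fix p assume "u = - ([:-1, 1:] * [:-6, 1:]) + p * [:-2, 1:] * [:-4, 1:] * [:-6, 1:]"
  then show "nilpotency_index u 2 = 3" "associated_seq u 2 = [2, 4, 6, 0]"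
    using nilpotency_orbit_3[of u 2 4 6] by simp_all
next
  fix p assume "u = - ([:-5, 1:] * [:5, -4, 1:]) + p * [:-2, 1:] * [:-3, 1:] * [:-4, 1:] * [:-5, 1:]"
  then show "nilpotency_index u 2 = 4" "associated_seq u 2 = [2, 3, 4, 5, 0]"
    using nilpotency_orbit_4[of u 2 3 4 5] by simp_all
qed

end
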